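(* Let $f_1,\dots,f_{s_f}\in\mathbb{R}[x,\omega]$, $K^j:=\{(x,\omega)\in X\times\Omega: f_j(x,\omega)\le0\}$ for $j=1,\dots,s_f$, and $K:=\bigcup_{j=1}^{s_f}K^j$. Consider the linear programs $$\rho=\sup_{\phi,\psi}\{\,\phi(K):\ \phi\le T^*\psi,\ \psi_x=\lambda,\ \phi\in\mathscr{M}_+(K),\ \psi\in\mathscr{P}(X\times A)\,\}\qquad(P)$$ and $$\hat\rho=\sup_{\phi_1,\dots,\phi_{s_f},\psi}\Big\{\sum_{j=1}^{s_f}\int_{K^j}d\phi_j:\ \sum_{j=1}^{s_f}\phi_j\le T^*\psi,\ \psi_x=\lambda,\ \phi_j\in\mathscr{M}_+(K^j)\ (j=1,\dots,s_f),\ \psi\in\mathscr{P}(X\times A)\Big\}.\qquad(\hat P)$$ Then: (i) The optimal value $\rho$ of (P) and the optimal value $\hat\rho$ of $(\hat P)$ are identical. (ii) Define on $K$ the functions $$\theta_j(x,\omega):=\frac{1}{|\{\ell\in\{1,\dots,s_f\}:(x,\omega)\in K^\ell\}|},\qquad j=1,\dots,s_f,$$ and let $(\phi^*,\psi^* )$ be an optimal solution of (P). Then $(\phi^*_1,\dots,\phi^*_{s_f},\psi^* )$ with $$d\phi^*_j(x,\omega):=1_{K^j}(x,\omega)\,\theta_j(x,\omega)\,d\phi^*(x,\omega),\qquad j=1,\dots,s_f,$$ is an optimal solution of $(\hat P)$, and $\phi^*=\sum_{j=1}^{s_f}\phi^*_j$.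
   Context: A basic semi-algebraic set is a set of the form $\{z: g_j(z)\ge 0,\ j\in J\}$ for finitely many polynomials $g_j$. $X\subset\mathbb{R}^n$ and $A\subset\mathbb{R}^t$ are compact (nonempty) basic semi-algebraic sets, $\Omega\subset\mathbb{R}^p$ is a basic semi-algebraic set, not necessarily compact. $\lambda$ is the Lebesgue measure on $X$ normalized to a probability measure (so $X$ has positive Lebesgue measure). For a closed set $Z$, $\mathcal{B}(Z)$ is its Borel $\sigma$-field, $\mathscr{P}(Z)$ the probability measures on $Z$, $\mathscr{M}(Z)$ the finite signed Borel measures, $\mathscr{M}_+(Z)$ the finite positive Borel measures. $\{\mu_a:a\in A\}\subset\mathscr{P}(\Omega)$ is a family satisfying the standing assumption: (i) for every $B\in\mathcal{B}(\Omega)$, $a\mapsto\mu_a(B)$ is measurable; (ii) for every $\beta\in\mathbb{N}^p$ there is a polynomial $p_\beta\in\mathbb{R}[a]$ with $\int_\Omega\omega^\beta\,d\mu_a(\omega)=p_\beta(a)$ for all $a\in A$; (iii) for every $a\in A$ and every nonzero polynomial $g\in\mathbb{R}[\omega]$, $\mu_a(\{\omega:g(\omega)=0\})=0$; (iv) for every bounded measurable (resp. bounded continuous) function $q$ on $X\times\Omega$, the function $(x,a)\mapsto\int_\Omega q(x,\omega)\,d\mu_a(\omega)$ is bounded measurable (resp. bounded continuous) on $X\times A$. $T$ maps a bounded measurable function $g$ on $X\times\Omega$ to the bounded measurable function $Tg(x,a)=\int_\Omega g(x,\omega)\,d\mu_a(\omega)$ on $X\times A$. Its adjoint $T^*:\mathscr{M}(X\times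 A)\to\mathscr{M}(X\times\Omega)$ is defined by $\int g\,d(T^*\psi)=\int Tg\,d\psi$ for all bounded measurable $g$ on $X\times\Omega$. $\psi_x$ denotes the marginal of $\psi$ on $X$. Measures on $K$ or $K^j$ are also viewed as measures on $X\times\Omega$, and $\le$ between measures is the setwise order. The measures $\phi_j$ in $(\hat P)$ are not required to be mutually singular. *)

theory Defs
  imports "HOL-Probability.Probability"
begin

text \<open>
  Polynomials are taken as polynomial functions, \<^const>\<open>real_polynomial_function\<close>. Over the
  infinite field of reals a polynomial in \<open>n\<close> variables is determined by its function on all
  of \<open>real ^ 'n\<close>, so a nonzero polynomial is a polynomial function other than \<open>\<lambda>_. 0\<close>.
  On the product type \<open>(real ^ 'n) \<times> (real ^ 'p)\<close> these are the polynomials in \<open>(x, \<omega>)\<close> jointly.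
\<close>

definition basic_semialgebraic :: "'a::euclidean_space set \<Rightarrow> bool" where
  "basic_semialgebraic S \<longleftrightarrow>
     (\<exists>G. finite G \<and> (\<forall>g\<in>G. real_polynomial_function g) \<and> S = {z. \<forall>g\<in>G. g z \<ge> 0})"

abbreviation borel_on :: "'a::topological_space set \<Rightarrow> 'a measure" where
  "borel_on Z \<equiv> restrict_space borel Z"

definition fin_measures :: "'a::topological_space set \<Rightarrow> 'a measure set" where
  "fin_measures Z = {M. sets M = sets (borel_on Z) \<and> finite_measure M}"

definition prob_measures :: "'a::topological_space set \<Rightarrow> 'a measure set" where
  "prob_measures Z = {M. sets M = sets (borel_on Z) \<and> prob_space M}"

definition bdd_measurable :: "'a::topological_space set \<Rightarrow> ('a \<Rightarrow> real) set" where
  "bdd_measurable Z = {g. g \<in> borel_measurable (borel_on Z) \<and> bounded (g ` Z)}"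

definition bdd_continuous :: "'a::topological_space set \<Rightarrow> ('a \<Rightarrow> real) set" where
  "bdd_continuous Z = {g. continuous_on Z g \<and> bounded (g ` Z)}"

definition normalized_lebesgue :: "'a::euclidean_space set \<Rightarrow> 'a measure" where
  "normalized_lebesgue X = uniform_measure (restrict_space lborel X) X"

definition T_op :: "('a \<Rightarrow> 'w measure) \<Rightarrow> ('x \<times> 'w \<Rightarrow> real) \<Rightarrow> 'x \<times> 'a \<Rightarrow> real" where
  "T_op \<mu> g = (\<lambda>(x, a). LINT \<omega>|\<mu> a. g (x, \<omega>))"

definition ambiguity_family ::
  "(real ^ 'n) set \<Rightarrow> (real ^ 't) set \<Rightarrow> (real ^ 'p) set \<Rightarrow> (real ^ 't \<Rightarrow> (real ^ 'p) measure) \<Rightarrow> bool"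
where
  "ambiguity_family X A \<Omega> \<mu> \<longleftrightarrow>
     (\<forall>a\<in>A. \<mu> a \<in> prob_measures \<Omega>) \<and>
     (\<forall>B\<in>sets (borel_on \<Omega>). (\<lambda>a. measure (\<mu> a) B) \<in> borel_measurable (borel_on A)) \<and>
     (\<forall>\<beta> :: 'p \<Rightarrow> nat. \<exists>q. real_polynomial_function q \<and>
        (\<forall>a\<in>A. has_bochner_integral (\<mu> a) (\<lambda>\<omega>. \<Prod>i\<in>UNIV. (\<omega> $ i) ^ \<beta> i) (q a))) \<and>
     (\<forall>a\<in>A. \<forall>g. real_polynomial_function g \<and> g \<noteq> (\<lambda>_. 0) \<longrightarrow>
        measure (\<mu> a) {\<omega>\<in>\<Omega>. g \<omega> = 0} = 0) \<and>
     (\<forall>q\<in>bdd_measurable (X \<times> \<Omega>). T_op \<mu> q \<in> bdd_measurable (X \<times> A)) \<and>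
     (\<forall>q\<in>bdd_continuous (X \<times> \<Omega>). T_op \<mu> q \<in> bdd_continuous (X \<times> A))"

text \<open>
  The adjoint of \<^const>\<open>T_op\<close>, for positive measures. For an ambiguity family and a
  probability measure \<open>\<psi>\<close> exactly one \<open>\<nu>\<close> fits the description, see \<open>T_adj_ex1\<close>.
\<close>

definition T_adj ::
  "(real ^ 'n) set \<Rightarrow> (real ^ 'p) set \<Rightarrow> (real ^ 't \<Rightarrow> (real ^ 'p) measure) \<Rightarrow>
   ((real ^ 'n) \<times> (real ^ 't)) measure \<Rightarrow> ((real ^ 'n) \<times> (real ^ 'p)) measure"
where
  "T_adj X \<Omega> \<mu> \<psi> =
     (THE \<nu>. \<nu> \<in> fin_measures (X \<times> \<Omega>) \<and>
        (\<forall>g\<in>bdd_measurable (X \<times> \<Omega>). (LINT z|\<nu>. g z) = (LINT y|\<psi>. T_op \<mu> g y)))"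

text \<open>A measure on a Borel subset of \<open>Z\<close>, viewed as a measure on \<open>Z\<close>.\<close>

definition extend_to :: "'a::topological_space set \<Rightarrow> 'a measure \<Rightarrow> 'a measure" where
  "extend_to Z \<phi> = distr \<phi> (borel_on Z) (\<lambda>z. z)"

definition Kj ::
  "(real ^ 'n) set \<Rightarrow> (real ^ 'p) set \<Rightarrow> (nat \<Rightarrow> (real ^ 'n) \<times> (real ^ 'p) \<Rightarrow> real) \<Rightarrow> nat \<Rightarrow>
   ((real ^ 'n) \<times> (real ^ 'p)) set"
where
  "Kj X \<Omega> f j = {z \<in> X \<times> \<Omega>. f j z \<le> 0}"

definition K_union ::
  "(real ^ 'n) set \<Rightarrow> (real ^ 'p) set \<Rightarrow> (nat \<Rightarrow> (real ^ 'n) \<times> (real ^ 'p) \<Rightarrow> real) \<Rightarrow> nat \<Rightarrow>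
   ((real ^ 'n) \<times> (real ^ 'p)) set"
where
  "K_union X \<Omega> f s = (\<Union>j\<in>{1..s}. Kj X \<Omega> f j)"

definition feasible_P ::
  "(real ^ 'n) set \<Rightarrow> (real ^ 't) set \<Rightarrow> (real ^ 'p) set \<Rightarrow> (real ^ 't \<Rightarrow> (real ^ 'p) measure) \<Rightarrow>
   (nat \<Rightarrow> (real ^ 'n) \<times> (real ^ 'p) \<Rightarrow> real) \<Rightarrow> nat \<Rightarrow>
   (((real ^ 'n) \<times> (real ^ 'p)) measure \<times> ((real ^ 'n) \<times> (real ^ 't)) measure) set"
where
  "feasible_P X A \<Omega> \<mu> f s = {(\<phi>, \<psi>).
     \<phi> \<in> fin_measures (K_union X \<Omega> f s) \<and>
     \<psi> \<in> prob_measures (X \<times> A) \<and>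
     distr \<psi> (borel_on X) fst = normalized_lebesgue X \<and>
     (\<forall>B\<in>sets (borel_on (X \<times> \<Omega>)).
        emeasure (extend_to (X \<times> \<Omega>) \<phi>) B \<le> emeasure (T_adj X \<Omega> \<mu> \<psi>) B)}"

definition objective_P ::
  "(real ^ 'n) set \<Rightarrow> (real ^ 'p) set \<Rightarrow> (nat \<Rightarrow> (real ^ 'n) \<times> (real ^ 'p) \<Rightarrow> real) \<Rightarrow> nat \<Rightarrow>
   ((real ^ 'n) \<times> (real ^ 'p)) measure \<times> ((real ^ 'n) \<times> (real ^ 't)) measure \<Rightarrow> real"
where
  "objective_P X \<Omega> f s = (\<lambda>(\<phi>, \<psi>). measure \<phi> (K_union X \<Omega> f s))"

text \<open>Only the components \<open>\<phi> j\<close> with \<open>1 \<le> j \<le> s\<close> of the family \<open>\<phi>\<close> matter below.\<close>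

definition feasible_P_hat ::
  "(real ^ 'n) set \<Rightarrow> (real ^ 't) set \<Rightarrow> (real ^ 'p) set \<Rightarrow> (real ^ 't \<Rightarrow> (real ^ 'p) measure) \<Rightarrow>
   (nat \<Rightarrow> (real ^ 'n) \<times> (real ^ 'p) \<Rightarrow> real) \<Rightarrow> nat \<Rightarrow>
   ((nat \<Rightarrow> ((real ^ 'n) \<times> (real ^ 'p)) measure) \<times> ((real ^ 'n) \<times> (real ^ 't)) measure) set"
where
  "feasible_P_hat X A \<Omega> \<mu> f s = {(\<phi>, \<psi>).
     (\<forall>j\<in>{1..s}. \<phi> j \<in> fin_measures (Kj X \<Omega> f j)) \<and>
     \<psi> \<in> prob_measures (X \<times> A) \<and>
     distr \<psi> (borel_on X) fst = normalized_lebesgue X \<and>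
     (\<forall>B\<in>sets (borel_on (X \<times> \<Omega>)).
        (\<Sum>j=1..s. emeasure (extend_to (X \<times> \<Omega>) (\<phi> j)) B) \<le> emeasure (T_adj X \<Omega> \<mu> \<psi>) B)}"

definition objective_P_hat ::
  "(real ^ 'n) set \<Rightarrow> (real ^ 'p) set \<Rightarrow> (nat \<Rightarrow> (real ^ 'n) \<times> (real ^ 'p) \<Rightarrow> real) \<Rightarrow> nat \<Rightarrow>
   (nat \<Rightarrow> ((real ^ 'n) \<times> (real ^ 'p)) measure) \<times> ((real ^ 'n) \<times> (real ^ 't)) measure \<Rightarrow> real"
where
  "objective_P_hat X \<Omega> f s = (\<lambda>(\<phi>, \<psi>). \<Sum>j=1..s. (LINT z:Kj X \<Omega> f j|\<phi> j. 1))"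

definition optimal_value :: "('v \<Rightarrow> real) \<Rightarrow> 'v set \<Rightarrow> ereal" where
  "optimal_value obj F = (SUP v\<in>F. ereal (obj v))"

definition optimal_solution :: "('v \<Rightarrow> real) \<Rightarrow> 'v set \<Rightarrow> 'v \<Rightarrow> bool" where
  "optimal_solution obj F v \<longleftrightarrow> is_arg_max obj (\<lambda>u. u \<in> F) v"

text \<open>The functions \<open>\<theta>\<^sub>j\<close> are the same for all \<open>j\<close>; they are only used on \<^const>\<open>K_union\<close>.\<close>

definition theta ::
  "(real ^ 'n) set \<Rightarrow> (real ^ 'p) set \<Rightarrow> (nat \<Rightarrow> (real ^ 'n) \<times> (real ^ 'p) \<Rightarrow> real) \<Rightarrow> nat \<Rightarrow>
   nat \<Rightarrow> (real ^ 'n) \<times> (real ^ 'p) \<Rightarrow> real"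
where
  "theta X \<Omega> f s j z = 1 / real (card {l \<in> {1..s}. z \<in> Kj X \<Omega> f l})"

definition phi_part ::
  "(real ^ 'n) set \<Rightarrow> (real ^ 'p) set \<Rightarrow> (nat \<Rightarrow> (real ^ 'n) \<times> (real ^ 'p) \<Rightarrow> real) \<Rightarrow> nat \<Rightarrow>
   ((real ^ 'n) \<times> (real ^ 'p)) measure \<Rightarrow> nat \<Rightarrow> ((real ^ 'n) \<times> (real ^ 'p)) measure"
where
  "phi_part X \<Omega> f s \<phi> j =
     restrict_space
       (density \<phi> (\<lambda>z. ennreal (indicator (Kj X \<Omega> f j) z * theta X \<Omega> f s j z)))
       (Kj X \<Omega> f j)"

lemma T_adj_ex1:
  fixes X :: "(real ^ 'n) set" and A :: "(real ^ 't) set" and \<Omega> :: "(real ^ 'p) set"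
  assumes fam: "ambiguity_family X A \<Omega> \<mu>" and \<psi>: "\<psi> \<in> prob_measures (X \<times> A)"
  shows "\<exists>!\<nu>. \<nu> \<in> fin_measures (X \<times> \<Omega>) \<and>
           (\<forall>g\<in>bdd_measurable (X \<times> \<Omega>). (LINT z|\<nu>. g z) = (LINT y|\<psi>. T_op \<mu> g y))"
proof (rule ex_ex1I)
  let ?N = "borel_on (X \<times> \<Omega>)"
  interpret \<psi>: prob_space \<psi> using \<psi> by (simp add: prob_measures_def)
  have sets\<psi>: "sets \<psi> = sets (borel_on (X \<times> A))" using \<psi> by (simp add: prob_measures_def)
  have sp\<psi>: "space \<psi> = X \<times> A" using sets_eq_imp_space_eq[OF sets\<psi>] by (simp add: space_restrict_space)
  define k where "k = (\<lambda>(x, a). distr (\<mu> a) ?N (\<lambda>\<omega>. (x, \<omega>)))"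
  have \<mu>: "prob_space (\<mu> a)" "sets (\<mu> a) = sets (borel_on \<Omega>)" if "a \<in> A" for a
    using fam that by (auto simp: ambiguity_family_def prob_measures_def)
  have meas: "(\<lambda>\<omega>. (x, \<omega>)) \<in> measurable (\<mu> a) ?N" if "x \<in> X" "a \<in> A" for x a
  proof -
    have "(\<lambda>\<omega>::real^'p. (x, \<omega>)) \<in> measurable borel borel"
      by (intro borel_measurable_continuous_onI continuous_intros)
    then have "(\<lambda>\<omega>. (x, \<omega>)) \<in> measurable (borel_on \<Omega>) ?N"
      using that by (intro measurable_restrict_space3) auto
    then show ?thesis using measurable_cong_sets[OF \<mu>(2)[OF that(2)] refl] by blast
  qed
  have k1: "prob_space (k y)" if "y \<in> X \<times> A" for y
    using that \<mu>(1) meas by (auto simp: k_def intro!: prob_space.prob_space_distr)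
  have ind: "(indicator B :: _ \<Rightarrow> real) \<in> bdd_measurable (X \<times> \<Omega>)" if "B \<in> sets ?N" for B
  proof -
    have "bounded ((indicator B :: _ \<Rightarrow> real) ` (X \<times> \<Omega>))"
      by (rule boundedI[where B=1]) (auto simp: indicator_def)
    then show ?thesis using that by (simp add: bdd_measurable_def)
  qed
  have int_k: "integral\<^sup>L (k y) g = T_op \<mu> g y"
    if "y \<in> X \<times> A" "g \<in> borel_measurable ?N" for y g
    using that meas by (auto simp: k_def T_op_def integral_distr)
  have kmeas: "k \<in> measurable \<psi> (subprob_algebra ?N)"
  proof (rule measurable_subprob_algebra)
    fix y assume y: "y \<in> space \<psi>"
    show "subprob_space (k y)" using k1 y sp\<psi> by (auto intro: prob_space_imp_subprob_space)
    show "sets (k y) = sets ?N" by (auto simp: k_def split: prod.splits)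
  next
    fix B assume B: "B \<in> sets ?N"
    have "T_op \<mu> (indicator B) \<in> bdd_measurable (X \<times> A)"
      using fam ind[OF B] by (auto simp: ambiguity_family_def)
    then have "T_op \<mu> (indicator B) \<in> borel_measurable \<psi>"
      using measurable_cong_sets[OF sets\<psi> refl] by (auto simp: bdd_measurable_def)
    moreover have "emeasure (k y) B = ennreal (T_op \<mu> (indicator B) y)" if "y \<in> space \<psi>" for y
    proof -
      interpret k: prob_space "k y" using k1 that sp\<psi> by auto
      have "sets (k y) = sets ?N" by (auto simp: k_def split: prod.splits)
      then show ?thesis
        using int_k[of y "indicator B"] that sp\<psi> B sets.sets_into_space[of B "k y"]
        by (auto simp: k.emeasure_eq_measure Int_absorb2)
    qed
    ultimately show "(\<lambda>y. emeasure (k y) B) \<in> borel_measurable \<psi>"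
      by (subst measurable_cong[where g="\<lambda>y. ennreal (T_op \<mu> (indicator B) y)"]) auto
  qed
  let ?\<nu> = "\<psi> \<bind> k"
  have ne: "space \<psi> \<noteq> {}" by (rule \<psi>.not_empty)
  have sets\<nu>: "sets ?\<nu> = sets ?N" by (rule sets_bind_measurable[OF kmeas ne])
  have "prob_space ?\<nu>"
    using k1 sp\<psi> by (intro \<psi>.prob_space_bind[OF _ kmeas]) (auto intro!: AE_I2)
  then have fin: "?\<nu> \<in> fin_measures (X \<times> \<Omega>)"
    using sets\<nu> by (simp add: fin_measures_def prob_space.finite_measure)
  have "(LINT z|?\<nu>. g z) = (LINT y|\<psi>. T_op \<mu> g y)" if g: "g \<in> bdd_measurable (X \<times> \<Omega>)" for g
  proof -
    have gm: "g \<in> borel_measurable ?N" using g by (simp add: bdd_measurable_def)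
    obtain C where C: "\<And>z. z \<in> X \<times> \<Omega> \<Longrightarrow> \<bar>g z\<bar> \<le> C"
      using g by (auto simp: bdd_measurable_def bounded_iff)
    have "(LINT z|?\<nu>. g z) = (LINT y|\<psi>. integral\<^sup>L (k y) g)"
    proof (rule integral_bind[where K = ?N and B' = 1 and B = C])
      show "finite_measure \<psi>" by unfold_locales
      show "AE y in \<psi>. emeasure (k y) (space (k y)) \<le> ennreal 1"
        using k1 sp\<psi> by (auto intro!: AE_I2 simp: prob_space.emeasure_space_1)
    qed (use kmeas gm C ne in \<open>auto simp: space_restrict_space\<close>)
    also have "\<dots> = (LINT y|\<psi>. T_op \<mu> g y)"
      using int_k gm sp\<psi> by (intro Bochner_Integration.integral_cong) auto
    finally show ?thesis .
  qed
  with fin show "\<exists>\<nu>. \<nu> \<in> fin_measures (X \<times> \<Omega>) \<and>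
           (\<forall>g\<in>bdd_measurable (X \<times> \<Omega>). (LINT z|\<nu>. g z) = (LINT y|\<psi>. T_op \<mu> g y))" by blast
  fix \<nu> \<nu>'
  assume a: "\<nu> \<in> fin_measures (X \<times> \<Omega>) \<and>
           (\<forall>g\<in>bdd_measurable (X \<times> \<Omega>). (LINT z|\<nu>. g z) = (LINT y|\<psi>. T_op \<mu> g y))"
    and b: "\<nu>' \<in> fin_measures (X \<times> \<Omega>) \<and>
           (\<forall>g\<in>bdd_measurable (X \<times> \<Omega>). (LINT z|\<nu>'. g z) = (LINT y|\<psi>. T_op \<mu> g y))"
  show "\<nu> = \<nu>'"
  proof (rule measure_eqI)
    show "sets \<nu> = sets \<nu>'" using a b by (simp add: fin_measures_def)
    fix B assume B: "B \<in> sets \<nu>"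
    interpret \<nu>: finite_measure \<nu> using a by (simp add: fin_measures_def)
    interpret \<nu>': finite_measure \<nu>' using b by (simp add: fin_measures_def)
    have s: "sets \<nu> = sets ?N" "sets \<nu>' = sets ?N" using a b by (auto simp: fin_measures_def)
    have "(LINT z|\<nu>. indicator B z) = (LINT z|\<nu>'. (indicator B z :: real))"
      using bspec[OF conjunct2[OF a] ind[of B]] bspec[OF conjunct2[OF b] ind[of B]] B s by metis
    then have "measure \<nu> B = measure \<nu>' B"
      using B s sets.sets_into_space[of B \<nu>] sets.sets_into_space[of B \<nu>']
      by (auto simp: Int_absorb2)
    then show "emeasure \<nu> B = emeasure \<nu>' B"
      by (simp add: \<nu>.emeasure_eq_measure \<nu>'.emeasure_eq_measure)
  qed
qed

end

theory Submission
  imports Defs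
begin

text \<open>
  Call a family of measures \<open>\<phi> j\<close> on the sets \<open>C j\<close> a \<^emph>\<open>splitting\<close> of a measure on \<open>\<Union>j. C j\<close> if the
  latter is the sum of the \<open>\<phi> j\<close>. When \<open>(\<phi> j)\<close> splits \<open>\<phi>\<close>, the pairs \<open>(\<phi>, \<psi>)\<close> and \<open>((\<phi> j), \<psi>)\<close>
  satisfy the domination constraint under the same condition, since both sides of it agree on every
  Borel set, and they have the same objective value (\<open>splitting_feasible_iff\<close>,
  \<open>splitting_objective_eq\<close>). So the two programs are equivalent once splittings exist in
  both directions. From \<open>(\<phi> j)\<close> one obtains \<open>\<phi>\<close> by adding the measures up (\<open>ex_sum_of_measures\<close>).
  From \<open>\<phi>\<close> one obtains the \<open>\<phi> j\<close> as densities with respect to \<open>\<phi>\<close>: at a point of the union,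
  \<open>1 / n\<close>, where \<open>n\<close> is the number of sets \<open>C j\<close> that contain the point, adds up to \<open>1\<close> over these
  sets (\<open>phi_part_splitting\<close>). This is the splitting in the second claim, and a splitting of an
  optimal solution is optimal because the two programs attain the same objective values.
\<close>

section \<open>Splittings of a measure on a finite union\<close>

text \<open>
  For a finite index set \<open>I\<close>: the family \<open>\<phi>s\<close> of finite measures on the sets \<open>C j\<close> adds up to the finite measure \<open>\<phi>\<close> on their
  union. The \<open>C j\<close> may overlap and carry their own Borel structures, so a set is intersected with
  \<open>C j\<close> before it is measured by \<open>\<phi>s j\<close>.
\<close>

definition is_splitting ::
  "'i set \<Rightarrow> ('i \<Rightarrow> 'a::topological_space set) \<Rightarrow> 'a measure \<Rightarrow> ('i \<Rightarrow> 'a measure) \<Rightarrow> bool"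
where
  "is_splitting I C \<phi> \<phi>s \<longleftrightarrow>
     \<phi> \<in> fin_measures (\<Union>j\<in>I. C j) \<and>
     (\<forall>j\<in>I. \<phi>s j \<in> fin_measures (C j)) \<and>
     (\<forall>B\<in>sets (borel_on (\<Union>j\<in>I. C j)). emeasure \<phi> B = (\<Sum>j\<in>I. emeasure (\<phi>s j) (B \<inter> C j)))"

lemma Int_in_sets_borel_on:
  assumes "B \<in> sets (borel_on Z)" "Y \<subseteq> Z"
  shows "B \<inter> Y \<in> sets (borel_on Y)"
proof -
  from assms(1) obtain S where "S \<in> sets borel" "B = Z \<inter> S"
    by (auto simp: sets_restrict_space)
  then have "B \<inter> Y = Y \<inter> S" using assms(2) by auto
  then show ?thesis using \<open>S \<in> sets borel\<close> by (auto simp: sets_restrict_space)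
qed

lemma emeasure_extend_to:
  assumes "sets \<phi> = sets (borel_on Y)" "Y \<subseteq> Z" "B \<in> sets (borel_on Z)"
  shows "emeasure (extend_to Z \<phi>) B = emeasure \<phi> (B \<inter> Y)"
proof -
  have sp: "space \<phi> = Y"
    using sets_eq_imp_space_eq[OF assms(1)] by (simp add: space_restrict_space)
  have "(\<lambda>z. z) \<in> measurable (borel_on Y) (borel_on Z)"
    using assms(2) by (intro measurable_restrict_space3) auto
  then have "(\<lambda>z. z) \<in> measurable \<phi> (borel_on Z)"
    using measurable_cong_sets[OF assms(1) refl] by blast
  then show ?thesis
    using assms(3) sp by (simp add: extend_to_def emeasure_distr)
qed

lemma ex_sum_of_measures:
  fixes C :: "'i \<Rightarrow> 'a::topological_space set"
  assumes I: "finite I" and fs: "\<And>j. j \<in> I \<Longrightarrow> \<phi>s j \<in> fin_measures (C j)"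
  shows "\<exists>\<phi>. is_splitting I C \<phi> \<phi>s"
proof -
  let ?U = "\<Union>j\<in>I. C j"
  let ?m = "\<lambda>B. \<Sum>j\<in>I. emeasure (\<phi>s j) (B \<inter> C j)"
  define \<phi> where "\<phi> = measure_of ?U (sets (borel_on ?U)) ?m"
  have sa: "sigma_algebra ?U (sets (borel_on ?U))"
    using sets.sigma_algebra_axioms[of "borel_on ?U"] by (simp add: space_restrict_space)
  have sets: "sets \<phi> = sets (borel_on ?U)" and space: "space \<phi> = ?U"
    using sigma_algebra.sets_measure_of_eq[OF sa] sigma_algebra.space_measure_of_eq[OF sa]
    by (auto simp: \<phi>_def)
  have trace: "B \<inter> C j \<in> sets (\<phi>s j)" if "B \<in> sets (borel_on ?U)" "j \<in> I" for B j
    using Int_in_sets_borel_on[OF that(1), of "C j"] fs[OF that(2)] that(2)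
    by (auto simp: fin_measures_def)
  have em: "emeasure \<phi> B = ?m B" if "B \<in> sets (borel_on ?U)" for B
    unfolding \<phi>_def
  proof (rule emeasure_measure_of_sigma[OF sa _ _ that])
    show "positive (sets (borel_on ?U)) ?m" by (simp add: positive_def)
    show "countably_additive (sets (borel_on ?U)) ?m"
    proof (rule countably_additiveI)
      fix F :: "nat \<Rightarrow> 'a set"
      assume F: "range F \<subseteq> sets (borel_on ?U)" and disj: "disjoint_family F"
      have "(\<Sum>n. ?m (F n)) = (\<Sum>j\<in>I. \<Sum>n. emeasure (\<phi>s j) (F n \<inter> C j))"
        by (intro suminf_sum) simp
      also have "\<dots> = (\<Sum>j\<in>I. emeasure (\<phi>s j) (\<Union>n. F n \<inter> C j))"
        using F disj trace
        by (intro sum.cong refl suminf_emeasure) (auto simp: disjoint_family_on_def)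
      also have "\<dots> = ?m (\<Union>n. F n)"
        by (simp only: Int_UN_distrib2 UN_simps(4))
      finally show "(\<Sum>n. ?m (F n)) = ?m (\<Union>n. F n)" .
    qed
  qed
  have "emeasure \<phi> (space \<phi>) \<noteq> \<infinity>"
  proof -
    have "emeasure (\<phi>s j) (?U \<inter> C j) \<noteq> \<infinity>" if "j \<in> I" for j
      using fs[OF that] finite_measure.emeasure_finite by (auto simp: fin_measures_def)
    moreover have "?U \<in> sets (borel_on ?U)"
      using sets.top[of \<phi>] sets space by simp
    ultimately show ?thesis using I by (simp add: space em)
  qed
  then have "finite_measure \<phi>" by (intro finite_measureI) simp
  then have "is_splitting I C \<phi> \<phi>s"
    using sets em fs by (simp add: is_splitting_def fin_measures_def)
  then show ?thesis by blast
qed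

lemma emeasure_extend_to_splitting:
  assumes spl: "is_splitting I C \<phi> \<phi>s" and Z: "(\<Union>j\<in>I. C j) \<subseteq> Z" and B: "B \<in> sets (borel_on Z)"
  shows "emeasure (extend_to Z \<phi>) B = (\<Sum>j\<in>I. emeasure (extend_to Z (\<phi>s j)) B)"
proof -
  let ?U = "\<Union>j\<in>I. C j"
  have "emeasure (extend_to Z \<phi>) B = emeasure \<phi> (B \<inter> ?U)"
    using spl Z B by (intro emeasure_extend_to) (auto simp: is_splitting_def fin_measures_def)
  also have "\<dots> = (\<Sum>j\<in>I. emeasure (\<phi>s j) (B \<inter> ?U \<inter> C j))"
    using spl Int_in_sets_borel_on[OF B Z] unfolding is_splitting_def by blast
  also have "\<dots> = (\<Sum>j\<in>I. emeasure (extend_to Z (\<phi>s j)) B)"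
  proof (rule sum.cong[OF refl])
    fix j assume j: "j \<in> I"
    have "sets (\<phi>s j) = sets (borel_on (C j))" "C j \<subseteq> Z"
      using spl Z j by (auto simp: is_splitting_def fin_measures_def)
    then have "emeasure (extend_to Z (\<phi>s j)) B = emeasure (\<phi>s j) (B \<inter> C j)"
      using B by (rule emeasure_extend_to)
    moreover have "B \<inter> ?U \<inter> C j = B \<inter> C j" using j by auto
    ultimately show "emeasure (\<phi>s j) (B \<inter> ?U \<inter> C j) = emeasure (extend_to Z (\<phi>s j)) B"
      by simp
  qed
  finally show ?thesis .
qed

section \<open>Feasibility and objective values under a splitting\<close>

lemma splitting_feasible_iff:
  assumes "is_splitting {1..s} (Kj X \<Omega> f) \<phi> \<phi>s"
  shows "(\<phi>, \<psi>) \<in> feasible_P X A \<Omega> \<mu> f s \<longleftrightarrow> (\<phi>s, \<psi>) \<in> feasible_P_hat X A \<Omega> \<mu> f s"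
proof -
  have "(\<Union>j\<in>{1..s}. Kj X \<Omega> f j) \<subseteq> X \<times> \<Omega>" by (auto simp: Kj_def)
  from emeasure_extend_to_splitting[OF assms this] show ?thesis
    using assms by (auto simp: feasible_P_def feasible_P_hat_def is_splitting_def K_union_def)
qed

lemma splitting_objective_eq:
  assumes spl: "is_splitting {1..s} (Kj X \<Omega> f) \<phi> \<phi>s"
  shows "objective_P X \<Omega> f s (\<phi>, \<psi>) = objective_P_hat X \<Omega> f s (\<phi>s, \<psi>)"
proof -
  let ?K = "K_union X \<Omega> f s"
  have \<phi>: "sets \<phi> = sets (borel_on ?K)"
    and \<phi>s: "\<And>j. j \<in> {1..s} \<Longrightarrow> finite_measure (\<phi>s j) \<and> sets (\<phi>s j) = sets (borel_on (Kj X \<Omega> f j))"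
    and sum: "\<And>B. B \<in> sets (borel_on ?K) \<Longrightarrow>
                emeasure \<phi> B = (\<Sum>j=1..s. emeasure (\<phi>s j) (B \<inter> Kj X \<Omega> f j))"
    using spl by (auto simp: is_splitting_def fin_measures_def K_union_def)
  have sp: "space (\<phi>s j) = Kj X \<Omega> f j" if "j \<in> {1..s}" for j
    using sets_eq_imp_space_eq[of "\<phi>s j"] \<phi>s[OF that] by (simp add: space_restrict_space)
  have "?K \<in> sets (borel_on ?K)"
    using sets.top[of "borel_on ?K"] by (simp add: space_restrict_space)
  from sum[OF this] have "emeasure \<phi> ?K = (\<Sum>j=1..s. emeasure (\<phi>s j) (?K \<inter> Kj X \<Omega> f j))" .
  also have "\<dots> = (\<Sum>j=1..s. ennreal (measure (\<phi>s j) (Kj X \<Omega> f j)))"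
  proof (rule sum.cong[OF refl])
    fix j assume j: "j \<in> {1..s}"
    then have "?K \<inter> Kj X \<Omega> f j = Kj X \<Omega> f j" by (auto simp: K_union_def)
    then show "emeasure (\<phi>s j) (?K \<inter> Kj X \<Omega> f j) = ennreal (measure (\<phi>s j) (Kj X \<Omega> f j))"
      using \<phi>s[OF j] by (simp add: finite_measure.emeasure_eq_measure)
  qed
  also have "\<dots> = ennreal (\<Sum>j=1..s. measure (\<phi>s j) (Kj X \<Omega> f j))"
    by (simp add: sum_ennreal)
  finally have "measure \<phi> ?K = (\<Sum>j=1..s. measure (\<phi>s j) (Kj X \<Omega> f j))"
    by (simp add: measure_def sum_nonneg)
  also have "\<dots> = (\<Sum>j=1..s. (LINT z:Kj X \<Omega> f j|\<phi>s j. 1))"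
    by (rule sum.cong) (auto simp: set_lebesgue_integral_def sp)
  finally show ?thesis by (simp add: objective_P_def objective_P_hat_def)
qed

section \<open>The splitting by multiplicities\<close>

lemma sum_indicator_theta:
  assumes "z \<in> K_union X \<Omega> f s"
  shows "(\<Sum>j=1..s. indicator (Kj X \<Omega> f j) z * theta X \<Omega> f s j z) = 1"
proof -
  let ?L = "{l \<in> {1..s}. z \<in> Kj X \<Omega> f l}"
  have "card ?L \<noteq> 0" using assms by (auto simp: K_union_def)
  have "(\<Sum>j=1..s. indicator (Kj X \<Omega> f j) z * theta X \<Omega> f s j z) = (\<Sum>j\<in>?L. 1 / real (card ?L))"
    by (rule sum.mono_neutral_cong_right) (auto simp: theta_def)
  also have "\<dots> = 1" using \<open>card ?L \<noteq> 0\<close> by (simp only: sum_constant) simp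
  finally show ?thesis .
qed

lemma theta_measurable:
  assumes "\<And>l. l \<in> {1..s} \<Longrightarrow> Kj X \<Omega> f l \<in> sets M"
  shows "theta X \<Omega> f s j \<in> borel_measurable M"
proof -
  have "theta X \<Omega> f s j = (\<lambda>z. 1 / (\<Sum>l=1..s. indicator (Kj X \<Omega> f l) z))"
  proof
    fix z
    have "real (card {l \<in> {1..s}. z \<in> Kj X \<Omega> f l}) = (\<Sum>l=1..s. indicator (Kj X \<Omega> f l) z)"
      by (simp add: indicator_def sum.If_cases Int_def)
    then show "theta X \<Omega> f s j z = 1 / (\<Sum>l=1..s. indicator (Kj X \<Omega> f l) z)"
      by (simp add: theta_def)
  qed
  moreover have "(\<lambda>z. 1 / (\<Sum>l=1..s. indicator (Kj X \<Omega> f l) z :: real)) \<in> borel_measurable M"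
    using assms by (intro borel_measurable_divide borel_measurable_sum borel_measurable_indicator) auto
  ultimately show ?thesis by simp
qed

lemma Kj_in_sets_borel_on:
  assumes "real_polynomial_function (f j)" "j \<in> {1..s}"
  shows "Kj X \<Omega> f j \<in> sets (borel_on (K_union X \<Omega> f s))"
proof -
  have "continuous_on UNIV (f j)"
    using assms(1)
    by (intro continuous_on_polymonial_function) (simp add: real_polynomial_function_eq)
  then have "f j \<in> borel_measurable borel" by (rule borel_measurable_continuous_onI)
  then have "{z. f j z \<le> 0} \<in> sets borel"
    using borel_measurable_le[of "f j" borel "\<lambda>_. 0"] by simp
  moreover have "Kj X \<Omega> f j = K_union X \<Omega> f s \<inter> {z. f j z \<le> 0}"
    using assms(2) by (auto simp: K_union_def Kj_def)
  ultimately show ?thesis by (auto simp: sets_restrict_space)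
qed

lemma phi_part_splitting:
  assumes poly: "\<forall>j\<in>{1..s}. real_polynomial_function (f j)"
    and fin: "\<phi> \<in> fin_measures (K_union X \<Omega> f s)"
  shows "is_splitting {1..s} (Kj X \<Omega> f) \<phi> (phi_part X \<Omega> f s \<phi>)"
proof -
  let ?K = "K_union X \<Omega> f s"
  let ?C = "Kj X \<Omega> f"
  let ?d = "\<lambda>j z. ennreal (indicator (?C j) z * theta X \<Omega> f s j z)"
  have sets: "sets \<phi> = sets (borel_on ?K)" and fm: "finite_measure \<phi>"
    using fin by (auto simp: fin_measures_def)
  have space: "space \<phi> = ?K"
    using sets_eq_imp_space_eq[OF sets] by (simp add: space_restrict_space)
  have C: "?C j \<in> sets \<phi>" if "j \<in> {1..s}" for j
    using Kj_in_sets_borel_on poly that sets by blast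
  have sub: "?C j \<subseteq> ?K" if "j \<in> {1..s}" for j
    using that by (auto simp: K_union_def)
  have dm: "?d j \<in> borel_measurable \<phi>" if "j \<in> {1..s}" for j
    using theta_measurable[OF C] C[OF that] by measurable
  have part: "emeasure (phi_part X \<Omega> f s \<phi> j) (B \<inter> ?C j) = (\<integral>\<^sup>+z. ?d j z * indicator B z \<partial>\<phi>)"
    if j: "j \<in> {1..s}" and B: "B \<in> sets \<phi>" for j B
  proof -
    have "emeasure (phi_part X \<Omega> f s \<phi> j) (B \<inter> ?C j) = emeasure (density \<phi> (?d j)) (B \<inter> ?C j)"
      unfolding phi_part_def using C[OF j] by (intro emeasure_restrict_space) auto
    also have "\<dots> = (\<integral>\<^sup>+z. ?d j z * indicator (B \<inter> ?C j) z \<partial>\<phi>)"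
      using dm[OF j] B C[OF j] by (intro emeasure_density) auto
    also have "\<dots> = (\<integral>\<^sup>+z. ?d j z * indicator B z \<partial>\<phi>)"
      by (rule nn_integral_cong) (auto simp: indicator_def)
    finally show ?thesis .
  qed
  have sum: "emeasure \<phi> B = (\<Sum>j=1..s. emeasure (phi_part X \<Omega> f s \<phi> j) (B \<inter> ?C j))"
    if B: "B \<in> sets \<phi>" for B
  proof -
    have "(\<Sum>j=1..s. emeasure (phi_part X \<Omega> f s \<phi> j) (B \<inter> ?C j)) =
          (\<Sum>j=1..s. \<integral>\<^sup>+z. ?d j z * indicator B z \<partial>\<phi>)"
      using part B by (intro sum.cong) auto
    also have "\<dots> = (\<integral>\<^sup>+z. (\<Sum>j=1..s. ?d j z * indicator B z) \<partial>\<phi>)"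
      using dm B by (intro nn_integral_sum[symmetric]) auto
    also have "\<dots> = (\<integral>\<^sup>+z. indicator B z \<partial>\<phi>)"
    proof (rule nn_integral_cong)
      fix z assume "z \<in> space \<phi>"
      then have "(\<Sum>j=1..s. indicator (?C j) z * theta X \<Omega> f s j z) = 1"
        by (intro sum_indicator_theta) (simp add: space)
      moreover have "(\<Sum>j=1..s. ?d j z) = ennreal (\<Sum>j=1..s. indicator (?C j) z * theta X \<Omega> f s j z)"
        by (rule sum_ennreal) (simp add: theta_def)
      ultimately have "(\<Sum>j=1..s. ?d j z) = 1" by simp
      then show "(\<Sum>j=1..s. ?d j z * indicator B z) = indicator B z"
        by (simp add: sum_distrib_right[symmetric])
    qed
    also have "\<dots> = emeasure \<phi> B" using B by simp
    finally show ?thesis by simp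
  qed
  have "phi_part X \<Omega> f s \<phi> j \<in> fin_measures (?C j)" if j: "j \<in> {1..s}" for j
  proof -
    have "sets (phi_part X \<Omega> f s \<phi> j) = sets (restrict_space (borel_on ?K) (?C j))"
      unfolding phi_part_def by (intro sets_restrict_space_cong) (simp add: sets)
    also have "\<dots> = sets (borel_on (?C j))"
      using sub[OF j] by (simp add: sets_restrict_restrict_space Int_absorb1)
    finally have s: "sets (phi_part X \<Omega> f s \<phi> j) = sets (borel_on (?C j))" .
    have sp: "space (phi_part X \<Omega> f s \<phi> j) = ?K \<inter> ?C j"
      by (simp add: phi_part_def space_restrict_space space Int_commute)
    have "emeasure (phi_part X \<Omega> f s \<phi> j) (?K \<inter> ?C j) \<le>
          (\<Sum>l=1..s. emeasure (phi_part X \<Omega> f s \<phi> l) (?K \<inter> ?C l))"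
      by (rule member_le_sum[OF j]) auto
    also have "\<dots> = emeasure \<phi> ?K"
      using sum[of ?K] sets.top[of \<phi>] unfolding space by simp
    also have "\<dots> < \<infinity>"
      using finite_measure.emeasure_finite[OF fm] by (simp add: top.not_eq_extremum)
    finally have "finite_measure (phi_part X \<Omega> f s \<phi> j)"
      by (intro finite_measureI) (simp add: sp)
    with s show ?thesis by (simp add: fin_measures_def)
  qed
  then show ?thesis using fin sum sets by (simp add: is_splitting_def K_union_def)
qed

section \<open>Equivalence of the two programs\<close>

theorem theorem5p1:
  fixes X :: "(real ^ 'n) set" and A :: "(real ^ 't) set" and \<Omega> :: "(real ^ 'p) set"
    and \<mu> :: "(real ^ 't) \<Rightarrow> (real ^ 'p) measure"
    and f :: "nat \<Rightarrow> (real ^ 'n) \<times> (real ^ 'p) \<Rightarrow> real" and s :: nat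
  assumes "basic_semialgebraic X" "compact X" "X \<noteq> {}" "emeasure lborel X > 0"
    and "basic_semialgebraic A" "compact A" "A \<noteq> {}"
    and "basic_semialgebraic \<Omega>"
    and "ambiguity_family X A \<Omega> \<mu>"
    and "1 \<le> s" "\<forall>j\<in>{1..s}. real_polynomial_function (f j)"
  shows
    "optimal_value (objective_P X \<Omega> f s) (feasible_P X A \<Omega> \<mu> f s) =
       optimal_value (objective_P_hat X \<Omega> f s) (feasible_P_hat X A \<Omega> \<mu> f s) \<and>
     (\<forall>\<phi> \<psi>. optimal_solution (objective_P X \<Omega> f s) (feasible_P X A \<Omega> \<mu> f s) (\<phi>, \<psi>) \<longrightarrow>
       optimal_solution (objective_P_hat X \<Omega> f s) (feasible_P_hat X A \<Omega> \<mu> f s)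
         (phi_part X \<Omega> f s \<phi>, \<psi>) \<and>
       (\<forall>B\<in>sets (borel_on (K_union X \<Omega> f s)).
          emeasure \<phi> B =
          (\<Sum>j=1..s. emeasure (extend_to (K_union X \<Omega> f s) (phi_part X \<Omega> f s \<phi> j)) B)))"
proof (intro conjI allI impI)
  let ?P = "feasible_P X A \<Omega> \<mu> f s" and ?Q = "feasible_P_hat X A \<Omega> \<mu> f s"
  let ?p = "objective_P X \<Omega> f s" and ?q = "objective_P_hat X \<Omega> f s"
  have split: "is_splitting {1..s} (Kj X \<Omega> f) \<phi> (phi_part X \<Omega> f s \<phi>)" if "(\<phi>, \<psi>) \<in> ?P" for \<phi> \<psi>
    using that assms(11) by (intro phi_part_splitting) (auto simp: feasible_P_def)
  have to_hat: "(phi_part X \<Omega> f s \<phi>, \<psi>) \<in> ?Q" "?q (phi_part X \<Omega> f s \<phi>, \<psi>) = ?p (\<phi>, \<psi>)"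
    if "(\<phi>, \<psi>) \<in> ?P" for \<phi> \<psi>
    using splitting_feasible_iff[OF split[OF that]] that
      splitting_objective_eq[OF split[OF that], of \<psi>]
    by auto
  have from_hat: "\<exists>v\<in>?P. ?p v = ?q u" if "u \<in> ?Q" for u
  proof -
    obtain \<phi>s \<psi> where u: "u = (\<phi>s, \<psi>)" by (cases u)
    then have "\<And>j. j \<in> {1..s} \<Longrightarrow> \<phi>s j \<in> fin_measures (Kj X \<Omega> f j)"
      using that by (auto simp: feasible_P_hat_def)
    then obtain \<phi> where "is_splitting {1..s} (Kj X \<Omega> f) \<phi> \<phi>s"
      using ex_sum_of_measures[OF finite_atLeastAtMost] by metis
    from splitting_feasible_iff[OF this] splitting_objective_eq[OF this, of \<psi>]
    show ?thesis using that u by metis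
  qed
  have "?p ` ?P = ?q ` ?Q"
  proof (intro equalityI subsetI)
    fix r assume "r \<in> ?p ` ?P"
    then obtain \<phi> \<psi> where "(\<phi>, \<psi>) \<in> ?P" "r = ?p (\<phi>, \<psi>)" by auto
    with to_hat[of \<phi> \<psi>] show "r \<in> ?q ` ?Q" by (metis image_eqI)
  next
    fix r assume "r \<in> ?q ` ?Q"
    then show "r \<in> ?p ` ?P" using from_hat by force
  qed
  then have "ereal ` ?p ` ?P = ereal ` ?q ` ?Q" by simp
  then show "optimal_value ?p ?P = optimal_value ?q ?Q"
    by (simp add: optimal_value_def image_image)
  fix \<phi> \<psi> assume opt: "optimal_solution ?p ?P (\<phi>, \<psi>)"
  then have P: "(\<phi>, \<psi>) \<in> ?P" and max: "\<And>v. v \<in> ?P \<Longrightarrow> ?p v \<le> ?p (\<phi>, \<psi>)"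
    by (auto simp: optimal_solution_def is_arg_max_linorder)
  have "?q u \<le> ?q (phi_part X \<Omega> f s \<phi>, \<psi>)" if "u \<in> ?Q" for u
    using from_hat[OF that] max to_hat(2)[OF P] by metis
  then show "optimal_solution ?q ?Q (phi_part X \<Omega> f s \<phi>, \<psi>)"
    using to_hat(1)[OF P] by (simp add: optimal_solution_def is_arg_max_linorder)
  show "\<forall>B\<in>sets (borel_on (K_union X \<Omega> f s)).
          emeasure \<phi> B =
          (\<Sum>j=1..s. emeasure (extend_to (K_union X \<Omega> f s) (phi_part X \<Omega> f s \<phi> j)) B)"
  proof
    fix B assume B: "B \<in> sets (borel_on (K_union X \<Omega> f s))"
    have "sets \<phi> = sets (borel_on (K_union X \<Omega> f s))"
      using P by (simp add: feasible_P_def fin_measures_def)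
    then have "emeasure \<phi> B = emeasure (extend_to (K_union X \<Omega> f s) \<phi>) B"
      using emeasure_extend_to[of \<phi>, OF _ subset_refl B] sets.sets_into_space[OF B]
      by (simp add: space_restrict_space Int_absorb2)
    also have "\<dots> = (\<Sum>j=1..s. emeasure (extend_to (K_union X \<Omega> f s) (phi_part X \<Omega> f s \<phi> j)) B)"
      by (rule emeasure_extend_to_splitting[OF split[OF P] _ B]) (simp add: K_union_def)
    finally show "emeasure \<phi> B =
        (\<Sum>j=1..s. emeasure (extend_to (K_union X \<Omega> f s) (phi_part X \<Omega> f s \<phi> j)) B)" .
  qed
qed

end
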